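(* Let $Y$ be a connected, locally path connected Hausdorff space admitting a universal cover. Then $Y$ is path representable if and only if it has the following universal property: for every topological space $X$, two continuous maps $f,g:X\to Y$ are homotopic if and only if the map $(f,g):X\to Y\times Y$ has a lift $h:X\to\widehat Y_{\operatorname{diag}}$, i.e. a continuous map $h$ with $P\circ h=(f,g)$.
   Context: The diagonal cover of $Y$ is $\widehat Y_{\operatorname{diag}}=C([0,1];Y)/\!\sim$ with the quotient topology of the compact-open topology, where $\alpha\sim\beta$ if $\alpha,\beta$ are homotopic relative to their endpoints. The map $P=(P_0,P_1):\widehat Y_{\operatorname{diag}}\to Y\times Y$, $P([\gamma])=(\gamma(0),\gamma(1))$, is a covering map. $Y$ is path representable if $P_0,P_1:\widehat Y_{\operatorname{diag}}\to Y$ are homotopic. *)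

theory Defs
  imports "HOL-Analysis.Analysis"
begin

section \<open>Mapping spaces and quotient spaces\<close>

text \<open>Points of the mapping space are extensional functions, so that a point is determined by its
  values on the domain \<open>topspace X\<close> even though HOL functions are total.\<close>

definition compact_open_topology :: "'a topology \<Rightarrow> 'b topology \<Rightarrow> ('a \<Rightarrow> 'b) topology" where
  "compact_open_topology X Y =
     topology_generated_by
       {{f \<in> extensional (topspace X). continuous_map X Y f \<and> f ` K \<subseteq> U} | K U.
          compactin X K \<and> openin Y U}"

lemma topspace_compact_open_topology:
  "topspace (compact_open_topology X Y) = {f \<in> extensional (topspace X). continuous_map X Y f}"
proof -
  have "{f \<in> extensional (topspace X). continuous_map X Y f} \<in>
      {{f \<in> extensional (topspace X). continuous_map X Y f \<and> f ` K \<subseteq> U} | K U.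
          compactin X K \<and> openin Y U}"
    by (rule CollectI, rule exI[of _ "{}"], rule exI[of _ "{}"]) auto
  then show ?thesis
    unfolding compact_open_topology_def topology_generated_by_topspace by blast
qed

definition quotient_topology :: "'a topology \<Rightarrow> ('a \<times> 'a) set \<Rightarrow> 'a set topology" where
  "quotient_topology X R =
     topology (\<lambda>\<U>. \<U> \<subseteq> topspace X // R \<and> openin X {x \<in> topspace X. R `` {x} \<in> \<U>})"

lemma openin_quotient_topology:
  "openin (quotient_topology X R) \<U> \<longleftrightarrow>
     \<U> \<subseteq> topspace X // R \<and> openin X {x \<in> topspace X. R `` {x} \<in> \<U>}"
proof -
  have "istopology (\<lambda>\<U>. \<U> \<subseteq> topspace X // R \<and> openin X {x \<in> topspace X. R `` {x} \<in> \<U>})"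
    unfolding istopology_def
  proof (intro conjI allI impI; (elim conjE)?)
    fix S T
    assume "openin X {x \<in> topspace X. R `` {x} \<in> S}" "openin X {x \<in> topspace X. R `` {x} \<in> T}"
    then have "openin X ({x \<in> topspace X. R `` {x} \<in> S} \<inter> {x \<in> topspace X. R `` {x} \<in> T})"
      by (rule openin_Int)
    moreover have "{x \<in> topspace X. R `` {x} \<in> S} \<inter> {x \<in> topspace X. R `` {x} \<in> T} =
        {x \<in> topspace X. R `` {x} \<in> S \<inter> T}"
      by auto
    ultimately show "openin X {x \<in> topspace X. R `` {x} \<in> S \<inter> T}" by simp
  next
    fix \<K>
    assume K: "\<forall>K\<in>\<K>. K \<subseteq> topspace X // R \<and> openin X {x \<in> topspace X. R `` {x} \<in> K}"
    have "{x \<in> topspace X. R `` {x} \<in> \<Union>\<K>} = (\<Union>K\<in>\<K>. {x \<in> topspace X. R `` {x} \<in> K})"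
      by auto
    then show "openin X {x \<in> topspace X. R `` {x} \<in> \<Union>\<K>}"
      using K by auto
  qed auto
  then show ?thesis
    unfolding quotient_topology_def by (simp add: topology_inverse')
qed

lemma topspace_quotient_topology: "topspace (quotient_topology X R) = topspace X // R"
proof (rule antisym)
  show "topspace (quotient_topology X R) \<subseteq> topspace X // R"
    using openin_topspace openin_quotient_topology by blast
  have "{x \<in> topspace X. R `` {x} \<in> topspace X // R} = topspace X"
    by (auto intro: quotientI)
  then show "topspace X // R \<subseteq> topspace (quotient_topology X R)"
    by (intro openin_subset) (simp add: openin_quotient_topology)
qed

lemma quotient_map_quotient_topology: "quotient_map X (quotient_topology X R) (\<lambda>x. R `` {x})"
  unfolding quotient_map_def
  by (auto simp: topspace_quotient_topology openin_quotient_topology quotient_def)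


section \<open>Universal covers\<close>

definition homotopic_rel_endpoints :: "'a topology \<Rightarrow> (real \<Rightarrow> 'a) \<Rightarrow> (real \<Rightarrow> 'a) \<Rightarrow> bool" where
  "homotopic_rel_endpoints Y \<alpha> \<beta> \<longleftrightarrow>
     homotopic_with (\<lambda>\<gamma>. \<gamma> 0 = \<alpha> 0 \<and> \<gamma> 1 = \<alpha> 1) (top_of_set {0..1}) Y \<alpha> \<beta>"

definition simply_connected_space :: "'a topology \<Rightarrow> bool" where
  "simply_connected_space E \<longleftrightarrow>
     path_connected_space E \<and>
     (\<forall>\<gamma>. pathin E \<gamma> \<and> \<gamma> 0 = \<gamma> 1 \<longrightarrow> homotopic_rel_endpoints E \<gamma> (\<lambda>_. \<gamma> 0))"

text \<open>The library's \<^const>\<open>covering_space\<close>, transcribed from type-class topologies to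
  \<^typ>\<open>'a topology\<close>.\<close>

definition covering_map :: "'e topology \<Rightarrow> 'a topology \<Rightarrow> ('e \<Rightarrow> 'a) \<Rightarrow> bool" where
  "covering_map E Y p \<longleftrightarrow>
     continuous_map E Y p \<and> p ` topspace E = topspace Y \<and>
     (\<forall>y \<in> topspace Y. \<exists>U. y \<in> U \<and> openin Y U \<and>
        (\<exists>\<V>. \<Union>\<V> = {x \<in> topspace E. p x \<in> U} \<and>
             (\<forall>V \<in> \<V>. openin E V) \<and>
             pairwise disjnt \<V> \<and>
             (\<forall>V \<in> \<V>. homeomorphic_map (subtopology E V) (subtopology Y U) p)))"

definition universal_cover :: "'e topology \<Rightarrow> 'a topology \<Rightarrow> ('e \<Rightarrow> 'a) \<Rightarrow> bool" where
  "universal_cover E Y p \<longleftrightarrow> covering_map E Y p \<and> simply_connected_space E"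


section \<open>The diagonal cover\<close>

abbreviation path_space :: "'a topology \<Rightarrow> (real \<Rightarrow> 'a) topology" where
  "path_space Y \<equiv> compact_open_topology (top_of_set {0..1}) Y"

definition path_homotopy_rel :: "'a topology \<Rightarrow> ((real \<Rightarrow> 'a) \<times> (real \<Rightarrow> 'a)) set" where
  "path_homotopy_rel Y =
     {(\<alpha>, \<beta>). \<alpha> \<in> topspace (path_space Y) \<and> \<beta> \<in> topspace (path_space Y) \<and>
        homotopic_rel_endpoints Y \<alpha> \<beta>}"

definition diagonal_cover :: "'a topology \<Rightarrow> (real \<Rightarrow> 'a) set topology" where
  "diagonal_cover Y = quotient_topology (path_space Y) (path_homotopy_rel Y)"

text \<open>All paths in a class have the same endpoints, so the images below are singletons.\<close>

definition P0 :: "(real \<Rightarrow> 'a) set \<Rightarrow> 'a" where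
  "P0 c = the_elem ((\<lambda>\<gamma>. \<gamma> 0) ` c)"

definition P1 :: "(real \<Rightarrow> 'a) set \<Rightarrow> 'a" where
  "P1 c = the_elem ((\<lambda>\<gamma>. \<gamma> 1) ` c)"

definition P :: "(real \<Rightarrow> 'a) set \<Rightarrow> 'a \<times> 'a" where
  "P c = (P0 c, P1 c)"

lemma homotopic_rel_endpoints_ends:
  assumes "homotopic_rel_endpoints Y \<alpha> \<beta>"
  shows "\<beta> 0 = \<alpha> 0" "\<beta> 1 = \<alpha> 1"
  using homotopic_with_imp_property[OF assms[unfolded homotopic_rel_endpoints_def]] by auto

lemma equiv_path_homotopy_rel: "equiv (topspace (path_space Y)) (path_homotopy_rel Y)"
proof (rule equivI)
  show "path_homotopy_rel Y \<subseteq> topspace (path_space Y) \<times> topspace (path_space Y)"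
    by (auto simp: path_homotopy_rel_def)
  show "refl_on (topspace (path_space Y)) (path_homotopy_rel Y)"
    by (auto simp: refl_on_def path_homotopy_rel_def homotopic_rel_endpoints_def
        topspace_compact_open_topology)
  show "sym (path_homotopy_rel Y)"
  proof (rule symI)
    fix \<alpha> \<beta> assume "(\<alpha>, \<beta>) \<in> path_homotopy_rel Y"
    then show "(\<beta>, \<alpha>) \<in> path_homotopy_rel Y"
      using homotopic_rel_endpoints_ends[of Y \<alpha> \<beta>]
      by (auto simp: path_homotopy_rel_def homotopic_rel_endpoints_def homotopic_with_sym)
  qed
  show "trans (path_homotopy_rel Y)"
  proof (rule transI)
    fix \<alpha> \<beta> \<gamma> assume "(\<alpha>, \<beta>) \<in> path_homotopy_rel Y" "(\<beta>, \<gamma>) \<in> path_homotopy_rel Y"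
    then show "(\<alpha>, \<gamma>) \<in> path_homotopy_rel Y"
      using homotopic_rel_endpoints_ends[of Y \<alpha> \<beta>]
      by (auto simp: path_homotopy_rel_def homotopic_rel_endpoints_def intro: homotopic_with_trans)
  qed
qed

lemma P_class:
  assumes "\<gamma> \<in> topspace (path_space Y)"
  shows "P (path_homotopy_rel Y `` {\<gamma>}) = (\<gamma> 0, \<gamma> 1)"
proof -
  have "\<gamma> \<in> path_homotopy_rel Y `` {\<gamma>}"
    using equiv_class_self[OF equiv_path_homotopy_rel assms] .
  moreover have "\<delta> 0 = \<gamma> 0 \<and> \<delta> 1 = \<gamma> 1" if "\<delta> \<in> path_homotopy_rel Y `` {\<gamma>}" for \<delta>
    using that homotopic_rel_endpoints_ends[of Y \<gamma> \<delta>] by (auto simp: path_homotopy_rel_def)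
  ultimately have "(\<lambda>\<gamma>. \<gamma> 0) ` (path_homotopy_rel Y `` {\<gamma>}) = {\<gamma> 0}"
      "(\<lambda>\<gamma>. \<gamma> 1) ` (path_homotopy_rel Y `` {\<gamma>}) = {\<gamma> 1}"
    by blast+
  then show ?thesis
    by (simp add: P_def P0_def P1_def)
qed


section \<open>Path representability and the universal property\<close>

abbreviation homotopic_maps :: "'x topology \<Rightarrow> 'a topology \<Rightarrow> ('x \<Rightarrow> 'a) \<Rightarrow> ('x \<Rightarrow> 'a) \<Rightarrow> bool" where
  "homotopic_maps X Y f g \<equiv> homotopic_with (\<lambda>_. True) X Y f g"

definition path_representable :: "'a topology \<Rightarrow> bool" where
  "path_representable Y \<longleftrightarrow> homotopic_maps (diagonal_cover Y) Y P0 P1"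

definition has_diagonal_lift ::
  "'x topology \<Rightarrow> 'a topology \<Rightarrow> ('x \<Rightarrow> 'a) \<Rightarrow> ('x \<Rightarrow> 'a) \<Rightarrow> bool" where
  "has_diagonal_lift X Y f g \<longleftrightarrow>
     (\<exists>h. continuous_map X (diagonal_cover Y) h \<and> (\<forall>x \<in> topspace X. P (h x) = (f x, g x)))"

text \<open>The universal property of \<open>Y\<close> for one test space \<open>X\<close>. HOL cannot quantify over the type
  carrying \<open>X\<close> inside a formula. A statement about all test spaces therefore uses a free type
  \<open>'x\<close>, which ranges over all types at theorem level, together with the type
  \<open>(real \<Rightarrow> 'a) set\<close>, which carries the diagonal cover of \<open>Y\<close>. Including the latter is necessary:
  over a small type such as \<^typ>\<open>unit\<close> the property does not imply path representability.\<close>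

definition lifts_detect_homotopy :: "'x topology \<Rightarrow> 'a topology \<Rightarrow> bool" where
  "lifts_detect_homotopy X Y \<longleftrightarrow>
     (\<forall>f g. continuous_map X Y f \<and> continuous_map X Y g \<longrightarrow>
        (homotopic_maps X Y f g \<longleftrightarrow> has_diagonal_lift X Y f g))"

end

theory Submission
  imports Defs
begin

text \<open>By currying, a homotopy from \<open>f\<close> to \<open>g\<close> is a continuous family of paths, and its composition with the
  quotient map lifts \<open>(f, g)\<close>. Conversely, a lift \<open>h\<close> pulls a homotopy between \<open>P0\<close> and \<open>P1\<close> back to one
  between \<open>f\<close> and \<open>g\<close>. The universal property on the diagonal cover itself, where the identity lifts
  \<open>(P0, P1)\<close>, gives path representability.\<close>

text \<open>Currying is continuous by the tube lemma: compactness of \<open>K\<close> turns the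
  pointwise condition on \<open>K\<close> at one parameter into a condition on a whole neighbourhood
  of that parameter. The restriction makes each slice extensional, hence a point of the mapping
  space.\<close>

lemma continuous_map_curry_compact_open:
  assumes "continuous_map (prod_topology A X) Y H"
  shows "continuous_map X (compact_open_topology A Y) (\<lambda>x. restrict (\<lambda>a. H (a, x)) (topspace A))"
    (is "continuous_map X _ ?c")
proof -
  have slice: "continuous_map A Y (?c x)" if "x \<in> topspace X" for x
  proof -
    have "continuous_map A Y (H \<circ> (\<lambda>a. (a, x)))"
      using that by (intro continuous_map_compose[OF _ assms]) (auto intro: continuous_map_pairedI)
    then show ?thesis
      by (rule continuous_map_eq) simp
  qed
  show ?thesis
    unfolding compact_open_topology_def
  proof (rule continuous_on_generated_topo)
    fix S
    assume "S \<in> {{f \<in> extensional (topspace A). continuous_map A Y f \<and> f ` K \<subseteq> U} | K U.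
      compactin A K \<and> openin Y U}"
    then obtain K U where S: "S = {f \<in> extensional (topspace A). continuous_map A Y f \<and> f ` K \<subseteq> U}"
      and K: "compactin A K" and U: "openin Y U"
      by blast
    have KA: "K \<subseteq> topspace A"
      using K by (rule compactin_subset_topspace)
    let ?W = "{z \<in> topspace (prod_topology A X). H z \<in> U}"
    have W: "openin (prod_topology A X) ?W"
      using assms U by (rule openin_continuous_map_preimage)
    show "openin X (?c -` S \<inter> topspace X)"
    proof (subst openin_subopen, intro ballI)
      fix x assume x: "x \<in> ?c -` S \<inter> topspace X"
      \<comment> \<open>The tube lemma thickens this slice to a box \<open>M \<times> N\<close>
        inside \<open>?W\<close>; its factor \<open>N\<close> is the required neighbourhood of
        \<open>x\<close>.\<close>
      then have "K \<times> {x} \<subseteq> ?W"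
        using KA by (auto simp: S image_subset_iff subset_iff)
      then obtain M N where "openin X N" "K \<subseteq> M" "x \<in> N" "M \<times> N \<subseteq> ?W"
        using tube_lemma_left[OF W K, of x] x by auto
      moreover have "N \<subseteq> ?c -` S \<inter> topspace X"
      proof
        fix y assume "y \<in> N"
        moreover from this have "y \<in> topspace X"
          using \<open>openin X N\<close> openin_subset by blast
        ultimately show "y \<in> ?c -` S \<inter> topspace X"
          using \<open>K \<subseteq> M\<close> \<open>M \<times> N \<subseteq> ?W\<close> KA slice[of y] by (auto simp: S)
      qed
      ultimately show "\<exists>T. openin X T \<and> x \<in> T \<and> T \<subseteq> ?c -` S \<inter> topspace X"
        by blast
    qed
  next
    \<comment> \<open>The union of the subbasis is the whole mapping space, so this amounts to the
      continuity of the slices.\<close>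
    show "?c ` topspace X \<subseteq> \<Union> {{f \<in> extensional (topspace A). continuous_map A Y f \<and> f ` K \<subseteq> U} | K U.
      compactin A K \<and> openin Y U}"
      using slice topspace_compact_open_topology[of A Y]
      unfolding compact_open_topology_def topology_generated_by_topspace by auto
  qed
qed

text \<open>Singletons are compact, so the preimage of an open set under evaluation at
  \<open>a\<close> is itself a subbasic set, with \<open>K = {a}\<close>.\<close>

lemma continuous_map_compact_open_eval:
  assumes "a \<in> topspace A"
  shows "continuous_map (compact_open_topology A Y) Y (\<lambda>f. f a)"
  unfolding continuous_map
proof (intro conjI allI impI)
  show "(\<lambda>f. f a) ` topspace (compact_open_topology A Y) \<subseteq> topspace Y"
    using assms by (auto simp: topspace_compact_open_topology dest: continuous_map_image_subset_topspace)
next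
  fix U assume "openin Y U"
  moreover have "compactin A {a}"
    using assms by simp
  moreover have "{f \<in> topspace (compact_open_topology A Y). f a \<in> U} =
      {f \<in> extensional (topspace A). continuous_map A Y f \<and> f ` {a} \<subseteq> U}"
    by (auto simp: topspace_compact_open_topology)
  ultimately show "openin (compact_open_topology A Y) {f \<in> topspace (compact_open_topology A Y). f a \<in> U}"
    unfolding compact_open_topology_def by (intro topology_generated_by_Basis) blast
qed

lemma continuous_map_P0: "continuous_map (diagonal_cover Y) Y P0"
  and continuous_map_P1: "continuous_map (diagonal_cover Y) Y P1"
proof -
  \<comment> \<open>Both endpoint maps are treated at once: \<open>g\<close> is induced on classes
    by evaluation at \<open>t\<close>, and continuity descends along the quotient map.\<close>
  have "continuous_map (diagonal_cover Y) Y g"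
    if "t \<in> {0..1}" "\<And>\<gamma>. \<gamma> \<in> topspace (path_space Y) \<Longrightarrow> g (path_homotopy_rel Y `` {\<gamma>}) = \<gamma> t"
    for t :: real and g
  proof -
    have "continuous_map (path_space Y) Y (g \<circ> (\<lambda>\<gamma>. path_homotopy_rel Y `` {\<gamma>}))"
      using continuous_map_compact_open_eval[of t "top_of_set {0..1}" Y] that
      by (force elim: continuous_map_eq)
    then show ?thesis
      unfolding diagonal_cover_def
      by (simp only: continuous_compose_quotient_map_eq[OF quotient_map_quotient_topology])
  qed
  from this[of 0 P0] this[of 1 P1]
  show "continuous_map (diagonal_cover Y) Y P0" "continuous_map (diagonal_cover Y) Y P1"
    using P_class[of _ Y] by (auto simp: P_def)
qed

lemma homotopic_maps_imp_diagonal_lift: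
  assumes "homotopic_maps X Y f g"
  shows "has_diagonal_lift X Y f g"
proof -
  obtain H where H: "continuous_map (prod_topology (top_of_set {0..1::real}) X) Y H"
    and ends: "\<And>x. H (0, x) = f x" "\<And>x. H (1, x) = g x"
    using assms unfolding homotopic_with_def by blast
  let ?c = "\<lambda>x. restrict (\<lambda>t. H (t, x)) {0..1}"
  have c: "continuous_map X (path_space Y) ?c"
    using continuous_map_curry_compact_open[OF H] by simp
  have "continuous_map X (diagonal_cover Y) ((\<lambda>\<gamma>. path_homotopy_rel Y `` {\<gamma>}) \<circ> ?c)"
    unfolding diagonal_cover_def
    by (rule continuous_map_compose[OF c])
      (rule quotient_imp_continuous_map[OF quotient_map_quotient_topology])
  moreover have "P (((\<lambda>\<gamma>. path_homotopy_rel Y `` {\<gamma>}) \<circ> ?c) x) = (f x, g x)"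
    if "x \<in> topspace X" for x
    using P_class[of "?c x" Y] that continuous_map_image_subset_topspace[OF c] ends by auto
  ultimately show ?thesis
    unfolding has_diagonal_lift_def by blast
qed

lemma diagonal_lift_imp_homotopic_maps:
  assumes "path_representable Y" "has_diagonal_lift X Y f g"
  shows "homotopic_maps X Y f g"
proof -
  obtain h where h: "continuous_map X (diagonal_cover Y) h"
    and Ph: "\<And>x. x \<in> topspace X \<Longrightarrow> P (h x) = (f x, g x)"
    using assms(2) unfolding has_diagonal_lift_def by blast
  have "homotopic_maps X Y (P0 \<circ> h) (P1 \<circ> h)"
    using homotopic_with_compose_continuous_map_right[OF assms(1)[unfolded path_representable_def] h]
    by simp
  then show ?thesis
    \<comment> \<open>The lift equation holds only on \<open>topspace X\<close>, which suffices for
      replacing \<open>P0 \<circ> h\<close> and \<open>P1 \<circ> h\<close> by \<open>f\<close> and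
      \<open>g\<close>.\<close>
    by (rule homotopic_with_eq) (use Ph in \<open>auto simp: P_def\<close>)
qed

text \<open>The pair \<open>(P0, P1)\<close> is the universal test case: every pair with a lift is
  its pullback along that lift.\<close>

lemma lifts_detect_homotopy_imp_path_representable:
  assumes "lifts_detect_homotopy (diagonal_cover Y) Y"
  shows "path_representable Y"
proof -
  have "has_diagonal_lift (diagonal_cover Y) Y P0 P1"
    unfolding has_diagonal_lift_def by (rule exI[of _ id]) (simp add: P_def)
  then show ?thesis
    using assms continuous_map_P0 continuous_map_P1
    unfolding lifts_detect_homotopy_def path_representable_def by blast
qed

theorem proposition3p2:
  fixes Y :: "'a topology" and E :: "'e topology" and p :: "'e \<Rightarrow> 'a"
  assumes "connected_space Y"
    and "locally_path_connected_space Y"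
    and "Hausdorff_space Y"
    and "universal_cover E Y p"
  shows "path_representable Y \<longleftrightarrow>
    (\<forall>X :: 'x topology. lifts_detect_homotopy X Y) \<and>
    (\<forall>X :: (real \<Rightarrow> 'a) set topology. lifts_detect_homotopy X Y)"
proof
  assume "path_representable Y"
  then show "(\<forall>X :: 'x topology. lifts_detect_homotopy X Y) \<and>
    (\<forall>X :: (real \<Rightarrow> 'a) set topology. lifts_detect_homotopy X Y)"
    unfolding lifts_detect_homotopy_def
    by (auto intro: homotopic_maps_imp_diagonal_lift diagonal_lift_imp_homotopic_maps)
next
  assume "(\<forall>X :: 'x topology. lifts_detect_homotopy X Y) \<and>
    (\<forall>X :: (real \<Rightarrow> 'a) set topology. lifts_detect_homotopy X Y)"
  \<comment> \<open>The second conjunct is instantiated at \<open>diagonal_cover Y\<close>, whose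
    points are sets of paths.\<close>
  then show "path_representable Y"
    by (auto intro: lifts_detect_homotopy_imp_path_representable)
qed

end
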